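(* Let $\mathcal V\subseteq\mathbb R^n$ be a regular space with ground set $E=\{1,\dots,n\}$, let $r\in E$, and let $c:E\setminus\{r\}\to\mathbb R_+$ be a capacity function. Then the Ford-Fulkerson method for the max-flow problem $\max\{f_r \mid f \text{ is a feasible flow}\}$ in $\mathcal V$ requires at most $|E|^2$ augmentations if augmenting paths $P$ of shortest possible length $|P|$ are always selected. That is: if $f^0=0,f^1,\dots,f^N$ are flows in $\mathcal V$ such that for each $i=0,\dots,N-1$ one has $f^{i+1}=f^i+\varepsilon_iP^i$, where $P^i$ is an augmenting $r$-path for $f^i$ whose length $|P^i|$ is minimal among all augmenting $r$-paths for $f^i$, and $\varepsilon_i>0$ is maximal such that $f^i+\varepsilon_iP^i$ is feasible, then $N\le |E|^2$.
   Context: Let $\mathcal V\subseteq\mathbb R^n$ be a linear subspace and $E=\{1,\dots,n\}$. The support of $x\in\mathbb R^n$ is $\|x\|=\{j\in E\mid x_j\ne 0\}$. A nonzero $x\in\mathcal V$ is elementary if no nonzero $y\in\mathcal V$ has support properly contained in $\|x\|$. A primitive vector is an elementary vector of $\mathcal V$ all of whose components lie in $\{-1,0,+1\}$. $\mathcal V$ is regular if every elementary vector is a scalar multiple of a primitive vector (equivalently, $\mathcal V$ is the kernel, or the row space, of a totally unimodular matrix). Fix $r\in E$ and $c:E\setminus\{r\}\to\mathbb R_+$ (nonnegative reals). A flow is an element $f\in\mathcal V$; it is feasible if $0\le f_j\le c_j$ for all $j\ne r$ (no restriction is placed on $f_r$). An $r$-path (or path) is a primitive vector $P\in\mathcal V$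 with $P_r=+1$. Given a feasible flow $f$, an $r$-path $P$ is augmenting for $f$ if there is some $\varepsilon>0$ such that $f+\varepsilon P$ is feasible. The length of $x\in\mathbb R^n$ is $|x|=\sum_{j=1}^n|x_j|$. The Ford-Fulkerson method: start with $f=0$; given the current feasible flow $f$, determine an augmenting path $P$ for $f$ and $\varepsilon>0$ maximal such that $f+\varepsilon P$ is feasible, replace $f$ by $f+\varepsilon P$ (one augmentation), and repeat until the current flow admits no augmenting path. *)

theory Defs
  imports "HOL-Analysis.Analysis"
begin

definition vec_support :: "real ^ 'n \<Rightarrow> 'n set" where
  "vec_support x = {j. x $ j \<noteq> 0}"

definition elementary :: "(real ^ 'n) set \<Rightarrow> real ^ 'n \<Rightarrow> bool" where
  "elementary V x \<longleftrightarrow>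
     x \<in> V \<and> x \<noteq> 0 \<and> (\<nexists>y. y \<in> V \<and> y \<noteq> 0 \<and> vec_support y \<subset> vec_support x)"

definition primitive :: "(real ^ 'n) set \<Rightarrow> real ^ 'n \<Rightarrow> bool" where
  "primitive V x \<longleftrightarrow> elementary V x \<and> (\<forall>j. x $ j \<in> {-1, 0, 1})"

definition regular_subspace :: "(real ^ 'n) set \<Rightarrow> bool" where
  "regular_subspace V \<longleftrightarrow>
     subspace V \<and> (\<forall>x. elementary V x \<longrightarrow> (\<exists>a p. primitive V p \<and> x = a *\<^sub>R p))"

text \<open>
  The capacity function lives on the ground set without \<open>r\<close>. Here it is a total
  function \<open>c\<close> whose value at \<open>r\<close> is never consulted.
\<close>

definition feasible_flow ::
    "(real ^ 'n) set \<Rightarrow> 'n \<Rightarrow> ('n \<Rightarrow> real) \<Rightarrow> real ^ 'n \<Rightarrow> bool" where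
  "feasible_flow V r c f \<longleftrightarrow> f \<in> V \<and> (\<forall>j. j \<noteq> r \<longrightarrow> 0 \<le> f $ j \<and> f $ j \<le> c j)"

definition r_path :: "(real ^ 'n) set \<Rightarrow> 'n \<Rightarrow> real ^ 'n \<Rightarrow> bool" where
  "r_path V r P \<longleftrightarrow> primitive V P \<and> P $ r = 1"

definition augmenting ::
    "(real ^ 'n) set \<Rightarrow> 'n \<Rightarrow> ('n \<Rightarrow> real) \<Rightarrow> real ^ 'n \<Rightarrow> real ^ 'n \<Rightarrow> bool" where
  "augmenting V r c f P \<longleftrightarrow>
     r_path V r P \<and> (\<exists>\<epsilon>>0. feasible_flow V r c (f + \<epsilon> *\<^sub>R P))"

definition vec_length :: "real ^ 'n \<Rightarrow> real" where
  "vec_length x = (\<Sum>j\<in>UNIV. \<bar>x $ j\<bar>)"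

definition shortest_augmenting ::
    "(real ^ 'n) set \<Rightarrow> 'n \<Rightarrow> ('n \<Rightarrow> real) \<Rightarrow> real ^ 'n \<Rightarrow> real ^ 'n \<Rightarrow> bool" where
  "shortest_augmenting V r c f P \<longleftrightarrow>
     augmenting V r c f P \<and> (\<forall>Q. augmenting V r c f Q \<longrightarrow> vec_length P \<le> vec_length Q)"

definition maximal_step ::
    "(real ^ 'n) set \<Rightarrow> 'n \<Rightarrow> ('n \<Rightarrow> real) \<Rightarrow> real ^ 'n \<Rightarrow> real ^ 'n \<Rightarrow> real \<Rightarrow> bool" where
  "maximal_step V r c f P \<epsilon> \<longleftrightarrow>
     \<epsilon> > 0 \<and> feasible_flow V r c (f + \<epsilon> *\<^sub>R P) \<and>
     (\<forall>\<delta>>0. feasible_flow V r c (f + \<delta> *\<^sub>R P) \<longrightarrow> \<delta> \<le> \<epsilon>)"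

end

theory Submission
  imports Defs
begin

text \<open>
  The proof transfers the Edmonds--Karp argument from graphs to regular spaces. The graph notion
  of splitting a sum of two paths is replaced by conformal decomposition: for each vector of \<open>V\<close>
  whose component at \<open>r\<close> is positive there is an elementary vector, also positive at \<open>r\<close>, whose
  nonzero components have the same signs as those of the given vector. By regularity that elementary vector may be taken to be an \<open>r\<close>-path. An
  integral \<open>x \<in> V\<close> with \<open>x\<^sub>r = 2\<close> thus contains two \<open>r\<close>-paths conformal to \<open>x\<close> of total length at
  most \<open>\<bar>x\<bar>\<close>, and one of them has length at most \<open>\<bar>x\<bar> / 2\<close> (\<open>short_conformal_r_path\<close>).

  This is applied to \<open>x = P + P'\<close>, where \<open>P\<close> is a shortest augmenting path for a flow and \<open>P'\<close> is a
  path used later. Opposite entries of \<open>P\<close> and \<open>P'\<close> cancel in \<open>x\<close>, so every conformal path is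
  still augmenting for the earlier flow as soon as \<open>P'\<close> is residual where \<open>P\<close> vanishes. Hence
  \<open>2 * \<bar>P\<bar> \<le> \<bar>P + P'\<bar> \<le> \<bar>P\<bar> + \<bar>P'\<bar>\<close>, and the last inequality is strict whenever \<open>P\<close> and \<open>P'\<close>
  traverse an element in opposite directions (\<open>exchange\<close>). Therefore path lengths never decrease
  (\<open>path_length_mono\<close>), and paths of equal length never oppose each other (\<open>no_opposition\<close>).

  Every augmentation of maximal step saturates some element \<open>j\<close>. As long as the path length stays
  the same, \<open>j\<close> remains saturated, because releasing it would require an opposing path; so no later
  path of that length saturates \<open>j\<close> again. The pairs (saturated element, path length) are thus
  distinct, and since lengths are integers between \<open>1\<close> and \<open>\<bar>E\<bar>\<close>, there are at most \<open>\<bar>E\<bar>\<^sup>2\<close> of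
  them.
\<close>

section \<open>Conformal vectors\<close>

definition conformal :: "real ^ 'n \<Rightarrow> real ^ 'n \<Rightarrow> bool" where
  "conformal y x \<longleftrightarrow> (\<forall>j. y $ j \<noteq> 0 \<longrightarrow> 0 < y $ j * x $ j)"

lemma conformal_refl: "conformal x x"
  by (auto simp: conformal_def zero_less_mult_iff)

lemma conformal_trans:
  assumes "conformal x y" "conformal y z"
  shows "conformal x z"
  unfolding conformal_def
proof (intro allI impI)
  fix j assume "x $ j \<noteq> 0"
  with assms(1) have xy: "0 < x $ j * y $ j" by (auto simp: conformal_def)
  then have "y $ j \<noteq> 0" by auto
  with assms(2) have "0 < y $ j * z $ j" by (auto simp: conformal_def)
  with xy show "0 < x $ j * z $ j" by (auto simp: zero_less_mult_iff)
qed

text \<open>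
  Adding the multiple of \<open>w\<close> that first annihilates an entry of \<open>y\<close> keeps all signs of \<open>y\<close> and
  removes that entry from the support. Only entries of opposite sign restrict the multiple, and a
  nonnegative \<open>w $ r\<close> can only increase the component at \<open>r\<close>.
\<close>
lemma conformal_shrink:
  fixes V :: "(real ^ 'n) set"
  assumes V: "subspace V" and y: "y \<in> V" and w: "w \<in> V"
    and sub: "vec_support w \<subseteq> vec_support y"
    and opp: "\<exists>j. w $ j * y $ j < 0" and r: "0 < y $ r" "0 \<le> w $ r"
  obtains z where "z \<in> V" "conformal z y" "0 < z $ r" "vec_support z \<subset> vec_support y"
proof -
  define J where "J = {j. w $ j * y $ j < 0}"
  define t where "t = Min ((\<lambda>j. \<bar>y $ j\<bar> / \<bar>w $ j\<bar>) ` J)"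
  have J: "finite J" "J \<noteq> {}" using opp by (auto simp: J_def)
  then have "t \<in> (\<lambda>j. \<bar>y $ j\<bar> / \<bar>w $ j\<bar>) ` J"
    unfolding t_def by (intro Min_in) auto
  then obtain k where k: "k \<in> J" "t = \<bar>y $ k\<bar> / \<bar>w $ k\<bar>" by auto
  have "w $ k \<noteq> 0" "y $ k \<noteq> 0" using k(1) by (auto simp: J_def)
  then have t_pos: "0 < t" by (simp add: k(2))
  have t_le: "t * \<bar>w $ j\<bar> \<le> \<bar>y $ j\<bar>" if "j \<in> J" for j
  proof -
    have "t \<le> \<bar>y $ j\<bar> / \<bar>w $ j\<bar>" unfolding t_def using J that by (intro Min_le) auto
    then show ?thesis using that by (auto simp: J_def field_simps mult_less_0_iff)
  qed
  define z where "z = y + t *\<^sub>R w"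
  have z_nth: "z $ j = y $ j + t * w $ j" for j by (simp add: z_def)
  have "z \<in> V" unfolding z_def using V y w by (simp add: subspace_add subspace_scale)
  moreover have conf: "conformal z y"
    unfolding conformal_def
  proof (intro allI impI)
    fix j assume nz: "z $ j \<noteq> 0"
    show "0 < z $ j * y $ j"
    proof (cases "j \<in> J")
      case True
      with t_le[OF True] nz t_pos show ?thesis
        by (auto simp: J_def z_nth mult_less_0_iff zero_less_mult_iff abs_if split: if_splits)
    next
      case False
      have "y $ j \<noteq> 0"
        using sub nz by (auto simp: vec_support_def z_nth)
      moreover have "0 \<le> t * (w $ j * y $ j)" using False t_pos by (auto simp: J_def)
      moreover have "z $ j * y $ j = y $ j * y $ j + t * (w $ j * y $ j)"
        by (simp add: z_nth algebra_simps)
      ultimately show ?thesis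
        by (smt (verit) not_real_square_gt_zero)
    qed
  qed
  moreover have "0 < z $ r" using r t_pos by (simp add: z_nth add_pos_nonneg)
  moreover have "vec_support z \<subset> vec_support y"
  proof -
    have "z $ k = 0"
      using k by (auto simp: z_nth J_def mult_less_0_iff abs_if)
    moreover have "y $ k \<noteq> 0" using k by (auto simp: J_def)
    moreover have "vec_support z \<subseteq> vec_support y"
      using conf by (auto simp: vec_support_def conformal_def)
    ultimately show ?thesis by (auto simp: vec_support_def)
  qed
  ultimately show thesis using that by blast
qed

text \<open>
  Among the vectors of \<open>V\<close> conformal to \<open>x\<close> and positive at \<open>r\<close>, one of minimal support is
  elementary: a nonzero vector \<open>w\<close> of smaller support, signed so that \<open>w $ r \<ge> 0\<close>, either competes
  itself or allows a further shrinking step.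
\<close>
lemma conformal_elementary:
  fixes V :: "(real ^ 'n) set"
  assumes V: "subspace V" and x: "x \<in> V" "0 < x $ r"
  shows "\<exists>z. elementary V z \<and> conformal z x \<and> 0 < z $ r"
proof -
  define Q where "Q y \<longleftrightarrow> y \<in> V \<and> conformal y x \<and> 0 < y $ r" for y
  have "Q x" using x by (simp add: Q_def conformal_refl)
  then obtain y where y: "Q y"
    and min: "\<And>z. Q z \<Longrightarrow> card (vec_support y) \<le> card (vec_support z)"
    using exists_least_iff[of "\<lambda>n. \<exists>y. Q y \<and> card (vec_support y) = n"]
    by (metis not_less)
  have no_smaller: "\<not> vec_support z \<subset> vec_support y" if "Q z" for z
    using min[OF that] psubset_card_mono[of "vec_support y" "vec_support z"] by auto
  have no_opp: False if w: "w \<in> V" "vec_support w \<subset> vec_support y" "0 \<le> w $ r"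
      and opp: "\<exists>j. w $ j * y $ j < 0" for w
  proof -
    obtain z where z: "z \<in> V" "conformal z y" "0 < z $ r" "vec_support z \<subset> vec_support y"
      using conformal_shrink[of V y w r] V w y opp by (auto simp: Q_def)
    then have "Q z" using y conformal_trans by (auto simp: Q_def)
    with no_smaller z show False by blast
  qed
  have no_smaller': False if w: "w \<in> V" "w \<noteq> 0" "vec_support w \<subset> vec_support y" "0 \<le> w $ r" for w
  proof -
    have "0 \<le> w $ j * y $ j" for j using no_opp[of w] w by (metis not_less)
    moreover have "w $ j \<noteq> 0 \<Longrightarrow> y $ j \<noteq> 0" for j using w by (auto simp: vec_support_def)
    ultimately have conf: "conformal w y"
      by (auto simp: conformal_def order_le_less)
    show False
    proof (cases "w $ r = 0")
      case True
      obtain j where "w $ j \<noteq> 0" using w(2) by (auto simp: vec_eq_iff)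
      then have "(- w) $ j * y $ j < 0" using conf by (auto simp: conformal_def)
      then show False
        using no_opp[of "- w"] w True V by (auto simp: vec_support_def subspace_neg)
    next
      case False
      then have "Q w" using w conf y conformal_trans by (auto simp: Q_def)
      with no_smaller w show False by blast
    qed
  qed
  have "elementary V y"
    unfolding elementary_def
  proof (intro conjI notI)
    show "y \<in> V" using y by (simp add: Q_def)
    show False if "y = 0" using y that by (simp add: Q_def)
    assume "\<exists>w. w \<in> V \<and> w \<noteq> 0 \<and> vec_support w \<subset> vec_support y"
    then obtain w where w: "w \<in> V" "w \<noteq> 0" "vec_support w \<subset> vec_support y" by blast
    have "vec_support (- w) = vec_support w" by (simp add: vec_support_def)
    then show False
      using no_smaller'[of w] no_smaller'[of "- w"] w V
      by (cases "0 \<le> w $ r") (auto simp: subspace_neg)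
  qed
  then show ?thesis using y by (auto simp: Q_def)
qed

lemma primitive_uminus:
  assumes "subspace V" "primitive V p"
  shows "primitive V (- p)"
proof -
  have "vec_support (- p) = vec_support p" by (simp add: vec_support_def)
  moreover have "(- p) $ j \<in> {- 1, 0, 1}" for j
  proof -
    have "p $ j = - 1 \<or> p $ j = 0 \<or> p $ j = 1" using assms(2) by (auto simp: primitive_def)
    then show ?thesis by auto
  qed
  ultimately show ?thesis
    using assms by (auto simp: primitive_def elementary_def subspace_neg)
qed

lemma r_path_nth:
  assumes "r_path V r P"
  shows "P $ j = -1 \<or> P $ j = 0 \<or> P $ j = 1"
  using assms by (auto simp: r_path_def primitive_def)

lemma r_path_in: "r_path V r P \<Longrightarrow> P \<in> V"
  by (simp add: r_path_def primitive_def elementary_def)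

lemma conformal_r_path:
  fixes V :: "(real ^ 'n) set"
  assumes V: "regular_subspace V" and x: "x \<in> V" "0 < x $ r"
  obtains P where "r_path V r P" "conformal P x"
proof -
  have sub: "subspace V" using V by (simp add: regular_subspace_def)
  obtain z where z: "elementary V z" "conformal z x" "0 < z $ r"
    using conformal_elementary[OF sub x] by blast
  obtain a p where p: "primitive V p" "z = a *\<^sub>R p"
    using V z(1) unfolding regular_subspace_def by blast
  have pr: "p $ r = -1 \<or> p $ r = 0 \<or> p $ r = 1" using p by (auto simp: primitive_def)
  show thesis
  proof (cases "0 < a")
    case True
    have "p $ r = 1" using pr z(3) True p by (auto simp: zero_less_mult_iff)
    moreover have "conformal p x"
      using z(2) True by (simp add: conformal_def p mult.assoc zero_less_mult_iff[of a])
    ultimately show thesis using that p by (auto simp: r_path_def)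
  next
    case False
    have a: "a < 0" using False z(3) p by (cases "a = 0") auto
    have "p $ r = -1" using pr z(3) a p by (auto simp: zero_less_mult_iff)
    moreover have "conformal (- p) x"
      using z(2) a by (auto simp: conformal_def p zero_less_mult_iff mult_less_0_iff)
    ultimately show thesis
      using that[of "- p"] primitive_uminus[OF sub p(1)] by (auto simp: r_path_def)
  qed
qed

text \<open>
  Integrality enters here: a nonzero integer has absolute value at least \<open>1\<close>, so subtracting a
  conformal path from an integral vector never overshoots zero. The remainder is again integral and
  conformal to \<open>x\<close>, and has component \<open>1\<close> at \<open>r\<close>, which yields a second path; the shorter of the
  two is the witness.
\<close>
lemma short_conformal_r_path:
  fixes V :: "(real ^ 'n) set"
  assumes V: "regular_subspace V" and x: "x \<in> V" "x $ r = 2" and int: "\<And>j. x $ j \<in> \<int>"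
  obtains P where "r_path V r P" "conformal P x" "2 * vec_length P \<le> vec_length x"
proof -
  have sub: "subspace V" using V by (simp add: regular_subspace_def)
  have remainder: "conformal (y - P) y \<and> vec_length (y - P) = vec_length y - vec_length P"
    if y: "\<And>j. y $ j \<in> \<int>" and P: "r_path V r P" "conformal P y" for y P
  proof -
    have *: "\<bar>y $ j - P $ j\<bar> = \<bar>y $ j\<bar> - \<bar>P $ j\<bar>
        \<and> (y $ j - P $ j \<noteq> 0 \<longrightarrow> 0 < (y $ j - P $ j) * y $ j)" for j
    proof (cases "P $ j = 0")
      case True
      then show ?thesis by (auto simp: zero_less_mult_iff)
    next
      case False
      have pos: "0 < P $ j * y $ j" using P(2) False by (auto simp: conformal_def)
      then have "1 \<le> \<bar>y $ j\<bar>" using y[of j] by (intro Ints_nonzero_abs_ge1) auto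
      then show ?thesis using r_path_nth[OF P(1), of j] False pos
        by (auto simp: zero_less_mult_iff)
    qed
    then show ?thesis
      by (simp add: conformal_def vec_length_def sum_subtractf)
  qed
  obtain P where P: "r_path V r P" "conformal P x"
    using conformal_r_path[OF V x(1), of r] x(2) by auto
  note Px = remainder[OF int P]
  have "x - P \<in> V" using sub x P by (simp add: r_path_in subspace_diff)
  moreover have "0 < (x - P) $ r" using x P by (simp add: r_path_def)
  ultimately obtain Q where Q: "r_path V r Q" "conformal Q (x - P)"
    using conformal_r_path[OF V] by blast
  have "(x - P) $ j \<in> \<int>" for j
    using int[of j] r_path_nth[OF P(1), of j] by auto
  note Qx = remainder[OF this Q]
  have "0 \<le> vec_length (x - P - Q)" by (simp add: vec_length_def sum_nonneg)
  with Px Qx have "vec_length P + vec_length Q \<le> vec_length x" by auto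
  moreover have "conformal Q x" using Q(2) Px conformal_trans by blast
  ultimately show thesis
    using that P Q by (cases "vec_length P \<le> vec_length Q") auto
qed

lemma vec_length_r_path:
  fixes P :: "real ^ 'n"
  assumes "r_path V r P"
  shows "vec_length P = card (vec_support P)"
proof -
  have "\<bar>P $ j\<bar> = (if j \<in> vec_support P then 1 else 0)" for j
    using r_path_nth[OF assms, of j] by (auto simp: vec_support_def)
  then have "vec_length P = (\<Sum>j\<in>UNIV. if j \<in> vec_support P then 1 else 0)"
    by (simp add: vec_length_def)
  also have "\<dots> = card (vec_support P)" by (simp add: sum.If_cases)
  finally show ?thesis .
qed

section \<open>Residual directions and exchange\<close>

definition residual :: "'n \<Rightarrow> ('n \<Rightarrow> real) \<Rightarrow> real ^ 'n \<Rightarrow> real ^ 'n \<Rightarrow> bool" where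
  "residual r c f x \<longleftrightarrow>
     (\<forall>j. j \<noteq> r \<longrightarrow> (0 < x $ j \<longrightarrow> f $ j < c j) \<and> (x $ j < 0 \<longrightarrow> 0 < f $ j))"

text \<open>
  Each of the finitely many bounds is respected for all small step sizes, hence all of them are
  respected by a common positive one.
\<close>
lemma feasible_step_iff_residual:
  fixes V :: "(real ^ 'n) set"
  assumes V: "subspace V" and f: "feasible_flow V r c f" and x: "x \<in> V"
  shows "(\<exists>\<epsilon>>0. feasible_flow V r c (f + \<epsilon> *\<^sub>R x)) \<longleftrightarrow> residual r c f x"
proof
  assume "\<exists>\<epsilon>>0. feasible_flow V r c (f + \<epsilon> *\<^sub>R x)"
  then obtain e where e: "e > 0" "feasible_flow V r c (f + e *\<^sub>R x)" by blast
  show "residual r c f x"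
    unfolding residual_def
  proof (intro allI impI conjI)
    fix j assume j: "j \<noteq> r"
    then have b: "0 \<le> f $ j + e * x $ j" "f $ j + e * x $ j \<le> c j"
      using e by (auto simp: feasible_flow_def)
    show "f $ j < c j" if "0 < x $ j" using mult_pos_pos[OF e(1) that] b by linarith
    show "0 < f $ j" if "x $ j < 0" using mult_pos_neg[OF e(1) that] b by linarith
  qed
next
  assume R: "residual r c f x"
  have "\<forall>j. eventually (\<lambda>e. j \<noteq> r \<longrightarrow> 0 \<le> f $ j + e * x $ j \<and> f $ j + e * x $ j \<le> c j)
      (at_right 0)"
  proof (intro allI)
    fix j
    show "eventually (\<lambda>e. j \<noteq> r \<longrightarrow> 0 \<le> f $ j + e * x $ j \<and> f $ j + e * x $ j \<le> c j)
      (at_right 0)"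
    proof (cases "j = r")
      case False
      have lim: "((\<lambda>e. f $ j + e * x $ j) \<longlongrightarrow> f $ j + 0 * x $ j) (at_right 0)"
        by (intro tendsto_intros)
      have f': "0 \<le> f $ j" "f $ j \<le> c j" using f False by (auto simp: feasible_flow_def)
      have pos: "eventually (\<lambda>e::real. 0 < e) (at_right 0)"
        by (simp add: eventually_at_right_less)
      have "eventually (\<lambda>e. 0 \<le> f $ j + e * x $ j) (at_right 0)"
      proof (cases "x $ j < 0")
        case True
        then have "0 < f $ j" using R False by (auto simp: residual_def)
        then have "eventually (\<lambda>e. 0 < f $ j + e * x $ j) (at_right 0)"
          using order_tendstoD(1)[OF lim, of 0] by simp
        then show ?thesis by (rule eventually_mono) simp
      next
        case False
        show ?thesis using pos by (rule eventually_mono) (use f' False in auto)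
      qed
      moreover have "eventually (\<lambda>e. f $ j + e * x $ j \<le> c j) (at_right 0)"
      proof (cases "0 < x $ j")
        case True
        then have "f $ j < c j" using R False by (auto simp: residual_def)
        then have "eventually (\<lambda>e. f $ j + e * x $ j < c j) (at_right 0)"
          using order_tendstoD(2)[OF lim, of "c j"] by simp
        then show ?thesis by (rule eventually_mono) simp
      next
        case False
        show ?thesis using pos
        proof (rule eventually_mono)
          fix e :: real assume "0 < e"
          then have "e * x $ j \<le> 0" using False by (simp add: mult_le_0_iff)
          then show "f $ j + e * x $ j \<le> c j" using f' by linarith
        qed
      qed
      ultimately show ?thesis by (rule eventually_elim2) simp
    qed simp
  qed
  then have "eventually (\<lambda>e. \<forall>j. j \<noteq> r \<longrightarrow> 0 \<le> f $ j + e * x $ j \<and> f $ j + e * x $ j \<le> c j)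
      (at_right 0)"
    by (intro eventually_all_finite) simp
  then have "eventually (\<lambda>e. 0 < e \<and>
      (\<forall>j. j \<noteq> r \<longrightarrow> 0 \<le> f $ j + e * x $ j \<and> f $ j + e * x $ j \<le> c j)) (at_right 0)"
    by (intro eventually_conj) (simp_all add: eventually_at_right_less)
  then obtain e where "0 < e"
      "\<And>j. j \<noteq> r \<Longrightarrow> 0 \<le> f $ j + e * x $ j \<and> f $ j + e * x $ j \<le> c j"
    using eventually_happens'[OF trivial_limit_at_right_real] by (metis (mono_tags, lifting))
  moreover have "f + e *\<^sub>R x \<in> V" for e
    using V f x by (simp add: feasible_flow_def subspace_add subspace_scale)
  ultimately show "\<exists>\<epsilon>>0. feasible_flow V r c (f + \<epsilon> *\<^sub>R x)"
    by (auto simp: feasible_flow_def)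
qed

lemma augmenting_iff_residual:
  assumes "subspace V" "feasible_flow V r c f"
  shows "augmenting V r c f P \<longleftrightarrow> r_path V r P \<and> residual r c f P"
  using feasible_step_iff_residual[OF assms r_path_in] by (auto simp: augmenting_def)

text \<open>
  A conformal path \<open>Q\<close> of \<open>P + P'\<close> uses an element only in a direction in which \<open>P\<close> uses it, or
  in which \<open>P'\<close> uses it while \<open>P\<close> vanishes. That is why residuality of \<open>P'\<close> is demanded only where
  \<open>P\<close> vanishes: with this much, \<open>Q\<close> is augmenting for \<open>f\<close> and cannot be shorter than \<open>P\<close>.
\<close>
lemma exchange:
  fixes V :: "(real ^ 'n) set"
  assumes V: "regular_subspace V" and f: "feasible_flow V r c f"
    and P: "shortest_augmenting V r c f P" and P': "r_path V r P'"
    and res: "\<And>j. j \<noteq> r \<Longrightarrow> P $ j = 0 \<Longrightarrow>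
      (0 < P' $ j \<longrightarrow> f $ j < c j) \<and> (P' $ j < 0 \<longrightarrow> 0 < f $ j)"
  shows "vec_length P \<le> vec_length P'"
    and "P $ j * P' $ j < 0 \<Longrightarrow> vec_length P < vec_length P'"
proof -
  have sub: "subspace V" using V by (simp add: regular_subspace_def)
  note aug = augmenting_iff_residual[OF sub f]
  have Pp: "r_path V r P" and Pres: "residual r c f P"
    using P aug by (auto simp: shortest_augmenting_def)
  have "P + P' \<in> V" using sub Pp P' by (simp add: r_path_in subspace_add)
  moreover have "(P + P') $ r = 2" using Pp P' by (simp add: r_path_def)
  moreover have "(P + P') $ j \<in> \<int>" for j
    using r_path_nth[OF Pp, of j] r_path_nth[OF P', of j] by auto
  ultimately obtain Q where Q: "r_path V r Q" "conformal Q (P + P')"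
      "2 * vec_length Q \<le> vec_length (P + P')"
    using short_conformal_r_path[OF V] by blast
  have "residual r c f Q"
    unfolding residual_def
  proof (intro allI impI conjI)
    fix j assume j: "j \<noteq> r"
    show "f $ j < c j" if "0 < Q $ j"
    proof -
      have "0 < Q $ j * (P $ j + P' $ j)" using Q(2) that by (simp add: conformal_def)
      then have "0 < P $ j + P' $ j" using that by (simp add: zero_less_mult_iff)
      then have "P $ j = 1 \<or> P $ j = 0 \<and> P' $ j = 1"
        using r_path_nth[OF Pp, of j] r_path_nth[OF P', of j] by auto
      then show ?thesis using Pres res j by (auto simp: residual_def)
    qed
    show "0 < f $ j" if "Q $ j < 0"
    proof -
      have "0 < Q $ j * (P $ j + P' $ j)" using Q(2) that by (simp add: conformal_def)
      then have "P $ j + P' $ j < 0" using that by (simp add: zero_less_mult_iff)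
      then have "P $ j = -1 \<or> P $ j = 0 \<and> P' $ j = -1"
        using r_path_nth[OF Pp, of j] r_path_nth[OF P', of j] by auto
      then show ?thesis using Pres res j by (auto simp: residual_def)
    qed
  qed
  then have "vec_length P \<le> vec_length Q"
    using P Q(1) aug by (auto simp: shortest_augmenting_def)
  with Q(3) have two: "2 * vec_length P \<le> vec_length (P + P')" by simp
  have sum: "vec_length P + vec_length P' = (\<Sum>j\<in>UNIV. \<bar>P $ j\<bar> + \<bar>P' $ j\<bar>)"
    by (simp add: vec_length_def sum.distrib)
  have "vec_length (P + P') \<le> vec_length P + vec_length P'"
    unfolding sum by (auto simp: vec_length_def intro!: sum_mono abs_triangle_ineq)
  with two show "vec_length P \<le> vec_length P'" by simp
  assume "P $ j * P' $ j < 0"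
  then have "\<bar>P $ j + P' $ j\<bar> < \<bar>P $ j\<bar> + \<bar>P' $ j\<bar>" by (auto simp: mult_less_0_iff)
  then have "vec_length (P + P') < vec_length P + vec_length P'"
    unfolding sum
    by (auto simp: vec_length_def intro!: sum_strict_mono_ex1 abs_triangle_ineq)
  with two show "vec_length P < vec_length P'" by simp
qed

text \<open>Otherwise a second step along the same path would extend the maximal one.\<close>
lemma maximal_step_saturates:
  assumes V: "subspace V" and P: "r_path V r P" and e: "maximal_step V r c f P \<epsilon>"
  shows "\<exists>j. j \<noteq> r \<and> (0 < P $ j \<and> (f + \<epsilon> *\<^sub>R P) $ j = c j \<or> P $ j < 0 \<and> (f + \<epsilon> *\<^sub>R P) $ j = 0)"
proof -
  have e': "0 < \<epsilon>" "feasible_flow V r c (f + \<epsilon> *\<^sub>R P)"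
    "\<And>\<delta>. 0 < \<delta> \<Longrightarrow> feasible_flow V r c (f + \<delta> *\<^sub>R P) \<Longrightarrow> \<delta> \<le> \<epsilon>"
    using e by (auto simp: maximal_step_def)
  have "\<not> residual r c (f + \<epsilon> *\<^sub>R P) P"
  proof
    assume "residual r c (f + \<epsilon> *\<^sub>R P) P"
    then obtain d where d: "0 < d" "feasible_flow V r c (f + \<epsilon> *\<^sub>R P + d *\<^sub>R P)"
      using feasible_step_iff_residual[OF V e'(2) r_path_in[OF P]] by blast
    then have "feasible_flow V r c (f + (\<epsilon> + d) *\<^sub>R P)" by (simp add: algebra_simps)
    with e'(3)[of "\<epsilon> + d"] e'(1) d show False by simp
  qed
  moreover have "0 \<le> (f + \<epsilon> *\<^sub>R P) $ j \<and> (f + \<epsilon> *\<^sub>R P) $ j \<le> c j" if "j \<noteq> r" for j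
    using e'(2) that by (auto simp: feasible_flow_def)
  ultimately show ?thesis unfolding residual_def by (meson antisym not_less)
qed

section \<open>Runs of the method with shortest paths\<close>

locale shortest_augmentation_run =
  fixes V :: "(real ^ 'n) set" and r :: 'n and c :: "'n \<Rightarrow> real"
    and f P :: "nat \<Rightarrow> real ^ 'n" and \<epsilon> :: "nat \<Rightarrow> real" and N :: nat
  assumes regular: "regular_subspace V"
    and start: "feasible_flow V r c (f 0)"
    and shortest: "i < N \<Longrightarrow> shortest_augmenting V r c (f i) (P i)"
    and maximal: "i < N \<Longrightarrow> maximal_step V r c (f i) (P i) (\<epsilon> i)"
    and step: "i < N \<Longrightarrow> f (Suc i) = f i + \<epsilon> i *\<^sub>R P i"
begin

lemma subspace: "subspace V"
  using regular by (simp add: regular_subspace_def)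

lemma feasible: "i \<le> N \<Longrightarrow> feasible_flow V r c (f i)"
  using start step maximal by (cases i) (auto simp: maximal_step_def)

lemma path: "i < N \<Longrightarrow> r_path V r (P i)"
  and path_residual: "i < N \<Longrightarrow> residual r c (f i) (P i)"
  using shortest augmenting_iff_residual[OF subspace feasible]
  by (auto simp: shortest_augmenting_def)

lemma path_length_step:
  assumes "Suc i < N"
  shows "vec_length (P i) \<le> vec_length (P (Suc i))"
proof (rule exchange(1)[OF regular])
  show "feasible_flow V r c (f i)" "shortest_augmenting V r c (f i) (P i)"
    "r_path V r (P (Suc i))"
    using assms by (simp_all add: feasible shortest path)
  fix j assume "j \<noteq> r" "P i $ j = 0"
  moreover from this have "f (Suc i) $ j = f i $ j" using assms by (simp add: step)
  ultimately show "(0 < P (Suc i) $ j \<longrightarrow> f i $ j < c j) \<and> (P (Suc i) $ j < 0 \<longrightarrow> 0 < f i $ j)"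
    using path_residual[OF assms] by (auto simp: residual_def)
qed

lemma path_length_mono:
  assumes "i \<le> k" "k < N"
  shows "vec_length (P i) \<le> vec_length (P k)"
  using assms
proof (induction k rule: dec_induct)
  case (step m)
  with path_length_step[of m] show ?case by simp
qed simp

text \<open>The factor \<open>s\<close> is used with values \<open>1\<close> and \<open>-1\<close> to treat both directions at once.\<close>
lemma flow_mono:
  assumes "i \<le> k" "k \<le> N" and "\<And>m. i \<le> m \<Longrightarrow> m < k \<Longrightarrow> 0 \<le> s * P m $ j"
  shows "s * f i $ j \<le> s * f k $ j"
  using assms
proof (induction k rule: dec_induct)
  case (step m)
  have "0 \<le> \<epsilon> m * (s * P m $ j)"
    using step maximal[of m] by (auto simp: maximal_step_def)
  moreover have "s * f (Suc m) $ j = s * f m $ j + \<epsilon> m * (s * P m $ j)"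
    using step by (simp add: shortest_augmentation_run.step[OF shortest_augmentation_run_axioms]
        algebra_simps)
  ultimately show ?case using step by auto
qed simp

text \<open>
  Suppose \<open>P i\<close> and \<open>P k\<close> have equal length, and that no path strictly between them opposes \<open>P k\<close>.
  Then an element used by \<open>P k\<close> and avoided by \<open>P i\<close> has only been moved in the direction of \<open>P k\<close>
  since step \<open>i\<close>, so that direction was already residual at step \<open>i\<close>, and an opposition between
  \<open>P i\<close> and \<open>P k\<close> would make \<open>P i\<close> strictly shorter than \<open>P k\<close> by exchange. Downward
  induction on \<open>i\<close> supplies the supposition.
\<close>
lemma no_opposition:
  assumes "i < k" "k < N" "vec_length (P i) = vec_length (P k)"
  shows "0 \<le> P i $ j * P k $ j"
  using assms
proof (induction "k - i" arbitrary: i j rule: less_induct)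
  case less
  have between: "0 \<le> P m $ j' * P k $ j'" if "i < m" "m < k" for m j'
  proof (rule less.hyps)
    show "vec_length (P m) = vec_length (P k)"
      using path_length_mono[of i m] path_length_mono[of m k] that less.prems by simp
  qed (use that less.prems in auto)
  have res: "(0 < P k $ j' \<longrightarrow> f i $ j' < c j') \<and> (P k $ j' < 0 \<longrightarrow> 0 < f i $ j')"
    if j': "j' \<noteq> r" "P i $ j' = 0" for j'
  proof -
    have eq: "f (Suc i) $ j' = f i $ j'" using less.prems j' by (simp add: step)
    have mono: "s * f i $ j' \<le> s * f k $ j'" if "s = P k $ j'" for s
      using flow_mono[of "Suc i" k s j'] between less.prems that
      by (simp add: eq mult.commute Suc_le_eq)
    have "residual r c (f k) (P k)" using less.prems by (simp add: path_residual)
    then show ?thesis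
      using mono[OF refl] j' by (auto simp: residual_def mult_le_cancel_left)
  qed
  show ?case
  proof (rule ccontr)
    assume neg: "\<not> 0 \<le> P i $ j * P k $ j"
    have "vec_length (P i) < vec_length (P k)"
    proof (rule exchange(2)[OF regular])
      show "feasible_flow V r c (f i)" "shortest_augmenting V r c (f i) (P i)" "r_path V r (P k)"
        using less.prems by (simp_all add: feasible shortest path)
      show "P i $ j * P k $ j < 0" using neg by simp
    qed (rule res)
    then show False using less.prems by simp
  qed
qed

text \<open>
  Between two steps of equal path length, the flow on an element used by the later path moves only
  in the direction of that path. The two paths do not oppose each other on \<open>j\<close>, so using \<open>j\<close>
  again would push its flow beyond the bound that it reached at step \<open>i\<close>.
\<close>
lemma saturated_not_reused:
  assumes ik: "i < k" "k < N" and len: "vec_length (P i) = vec_length (P k)" and j: "j \<noteq> r"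
    and sat: "0 < P i $ j \<and> f (Suc i) $ j = c j \<or> P i $ j < 0 \<and> f (Suc i) $ j = 0"
  shows "P k $ j = 0"
proof (rule ccontr)
  assume nz: "P k $ j \<noteq> 0"
  have "0 \<le> P k $ j * P m $ j" if "Suc i \<le> m" "m < k" for m
    using no_opposition[of m k j] path_length_mono[of i m] path_length_mono[of m k] that ik len
    by (simp add: mult.commute)
  then have "P k $ j * f (Suc i) $ j \<le> P k $ j * f k $ j"
    using ik by (intro flow_mono) auto
  moreover have "0 \<le> P i $ j * P k $ j" using no_opposition ik len by blast
  moreover have "residual r c (f k) (P k)" using ik by (simp add: path_residual)
  ultimately show False
    using sat nz j
    by (auto simp: residual_def mult_le_cancel_left zero_le_mult_iff)
qed

theorem augmentation_bound: "N \<le> CARD('n) ^ 2"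
proof -
  have "\<exists>j. j \<noteq> r \<and> (0 < P i $ j \<and> f (Suc i) $ j = c j \<or> P i $ j < 0 \<and> f (Suc i) $ j = 0)"
    if "i < N" for i
    using maximal_step_saturates[OF subspace path[OF that] maximal[OF that]]
    unfolding step[OF that] .
  then obtain crit where crit: "\<And>i. i < N \<Longrightarrow> crit i \<noteq> r \<and>
      (0 < P i $ crit i \<and> f (Suc i) $ crit i = c (crit i)
        \<or> P i $ crit i < 0 \<and> f (Suc i) $ crit i = 0)"
    by metis
  define label where "label i = (crit i, card (vec_support (P i)))" for i
  have distinct: "label i \<noteq> label k" if "i < k" "k < N" for i k
  proof
    assume "label i = label k"
    then have eq: "crit i = crit k" "vec_length (P i) = vec_length (P k)"
      using that by (simp_all add: label_def vec_length_r_path[OF path])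
    then have "P k $ crit k = 0"
      using saturated_not_reused[of i k "crit i"] crit[of i] that by simp
    then show False using crit[of k] that by simp
  qed
  have "inj_on label {..<N}"
    by (rule linorder_inj_onI) (use distinct in auto)
  moreover have "label ` {..<N} \<subseteq> UNIV \<times> {1..CARD('n)}"
  proof clarify
    fix i a b assume i: "i < N" and ab: "(a, b) = label i"
    have "r \<in> vec_support (P i)" using path[OF i] by (simp add: r_path_def vec_support_def)
    then have "1 \<le> card (vec_support (P i))" by (auto simp: Suc_le_eq card_gt_0_iff)
    then show "a \<in> UNIV \<and> b \<in> {1..CARD('n)}"
      using ab card_mono[of UNIV "vec_support (P i)"] by (simp add: label_def)
  qed
  ultimately have "card {..<N} \<le> card ((UNIV :: 'n set) \<times> {1..CARD('n)})"
    by (intro card_inj_on_le) auto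
  then show ?thesis by (simp add: power2_eq_square card_cartesian_product)
qed

end

theorem theorem2:
  fixes V :: "(real ^ 'n) set"
    and r :: 'n
    and c :: "'n \<Rightarrow> real"
    and f P :: "nat \<Rightarrow> real ^ 'n"
    and \<epsilon> :: "nat \<Rightarrow> real"
    and N :: nat
  assumes "regular_subspace V"
    and "\<And>j. j \<noteq> r \<Longrightarrow> 0 \<le> c j"
    and "f 0 = 0"
    and "\<And>i. i < N \<Longrightarrow> shortest_augmenting V r c (f i) (P i)"
    and "\<And>i. i < N \<Longrightarrow> maximal_step V r c (f i) (P i) (\<epsilon> i)"
    and "\<And>i. i < N \<Longrightarrow> f (Suc i) = f i + \<epsilon> i *\<^sub>R P i"
  shows "N \<le> CARD('n) ^ 2"
proof -
  have "feasible_flow V r c (f 0)"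
    using assms(1-3) by (auto simp: feasible_flow_def regular_subspace_def subspace_0)
  then interpret shortest_augmentation_run V r c f P \<epsilon> N
    using assms by unfold_locales auto
  show ?thesis by (rule augmentation_bound)
qed

end
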